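(* Let $v:\mathbb R^+\to[0,\infty)$ be a decreasing function, regarded also as the function $v(s,t)=v(t)$ on $\mathbb R^2_+$. For any measurable function $f$ on $\mathbb R^2$, $$\sup_{h_2^*=v}\int_{\mathbb R^2}|f(x,y)\,h(x,y)|\,dx\,dy=\int_{\mathbb R^2_+} f_2^*(s,t)\,v(t)\,ds\,dt,$$ where the supremum is taken over all measurable functions $h$ on $\mathbb R^2$ with $h_2^*(s,t)=v(t)$ for a.e. $(s,t)\in\mathbb R^2_+$.
   Context: $\mathbb R^+=(0,\infty)$ and $\mathbb R^2_+=\mathbb R^+\times\mathbb R^+$. For a measurable function $f$ on $\mathbb R^2$, its two-dimensional rearrangement $f_2^*(s,t)$, $s,t>0$, is obtained by iterating the classical decreasing rearrangement: $f_2^*(s,t)=(f_y^*(\cdot,t))_x^*(s)$. That is, for fixed $x$, $t\mapsto f_y^*(x,t)$ is the classical decreasing rearrangement (with respect to Lebesgue measure on $\mathbb R$) of the function $y\mapsto f(x,y)$; then, for fixed $t$, $s\mapsto f_2^*(s,t)$ is the classical decreasing rearrangement of the function $x\mapsto f_y^*(x,t)$. *)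

theory Defs
  imports "HOL-Analysis.Analysis"
begin

text \<open>
  Classical decreasing rearrangement of a nonnegative function on the line with respect to
  Lebesgue measure, \<open>g\<^sup>*(t) = inf {l \<ge> 0. |{g > l}| \<le> t}\<close> with \<open>inf {} = \<infinity>\<close>. The functions are
  \<open>ennreal\<close>-valued because the rearrangement of a finite function, to which the operation is
  applied again below, may be infinite. Letting \<open>l\<close> range over \<open>[0,\<infinity>]\<close> is the same as taking
  finite \<open>l\<close> only: \<open>l = \<infinity>\<close> always belongs to the set and accounts for \<open>inf {} = \<infinity>\<close>.
\<close>

definition decr_rearr :: "(real \<Rightarrow> ennreal) \<Rightarrow> real \<Rightarrow> ennreal" where
  "decr_rearr g t = Inf {l. emeasure lebesgue {x. l < g x} \<le> ennreal t}"

text \<open>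
  For fixed \<open>x\<close>, \<open>rearr_y f x\<close> is the rearrangement of the section \<open>f (x, _)\<close>. For a Lebesgue
  measurable \<open>f\<close>, almost every section is measurable. On the exceptional null set of \<open>x\<close> the
  value is irrelevant, as \<open>rearr_2\<close> ignores null sets of \<open>x\<close>.

  The class \<open>real_normed_field\<close> covers real-valued and complex-valued functions.
\<close>

definition rearr_y :: "(real \<times> real \<Rightarrow> 'a::real_normed_field) \<Rightarrow> real \<Rightarrow> real \<Rightarrow> ennreal" where
  "rearr_y f x t = decr_rearr (\<lambda>y. ennreal (norm (f (x, y)))) t"

definition rearr_2 :: "(real \<times> real \<Rightarrow> 'a::real_normed_field) \<Rightarrow> real \<Rightarrow> real \<Rightarrow> ennreal" where
  "rearr_2 f s t = decr_rearr (\<lambda>x. rearr_y f x t) s"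

abbreviation pos_quadrant :: "(real \<times> real) set" where
  "pos_quadrant \<equiv> {0<..} \<times> {0<..}"

end

theory Submission
  imports Defs
begin

text \<open>
  Only the moduli of \<open>f\<close> and \<open>h\<close> matter, so \<open>f\<close> is replaced by a nonnegative Borel function \<open>F\<close>
  that agrees with its modulus almost everywhere (lemma \<open>borel_modulus\<close>).

  The bound from above is the classical Hardy-Littlewood inequality, used once in \<open>y\<close> for each
  fixed \<open>x\<close> and once in \<open>x\<close> for each fixed \<open>t\<close> (lemma \<open>iterated_hardy_littlewood\<close>). The
  inequality itself comes from the layer cake formula, which turns both sides into integrals of
  measures of superlevel sets: an intersection has at most the smaller of the two measures, and
  for the rearrangements, whose superlevel sets are nested intervals, it has exactly that measure.

  For the bound from below, rearranging in \<open>x\<close> preserves integrals and \<open>v\<close> depends on \<open>t\<close> only.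
  The right-hand side is therefore the integral over \<open>x\<close> of \<open>\<integral> F\<^sub>y\<^sup>*(x,t) v(t) dt\<close>, and each
  section of \<open>F\<close> has to be paired with a function that has the same profile as \<open>v\<close> and is arranged
  in the same order as the section. If \<open>\<phi>(x,y)\<close> is the measure of the set of points that come
  before \<open>y\<close> in the order of decreasing \<open>F(x,\<cdot>)\<close>, this function is \<open>v \<circ> \<phi>(x,\<cdot>)\<close>. Three
  points need care.

  \<^item> The function \<open>\<phi>(x,\<cdot>)\<close> preserves measure only when \<open>F(x,\<cdot>)\<close> has no flat parts. On the
    interval \<open>[-n,n]\<close>, \<open>F\<close> is therefore replaced by its dyadic approximation, which has the form
    \<open>k / 2^n\<close> with integer-valued \<open>k\<close>, and points with the same value of \<open>k\<close> are ranked by position: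
    adding to \<open>k\<close> an increasing function of \<open>y\<close> with values in \<open>[0,1)\<close> makes it injective
    without changing the order of its levels (definition \<open>tie_break\<close>, lemma
    \<open>nn_integral_rearr_rank\<close>).

  \<^item> The dyadic approximations increase to \<open>F\<close>. Rearrangement commutes with increasing limits, so
    monotone convergence recovers the full integral (lemma \<open>nn_integral_rearr_y_approx\<close>).

  \<^item> The prescribed iterated rearrangement does not depend on \<open>s\<close>. A function has it as soon as
    every section has a rearrangement at most \<open>v\<close>, with equality for a set of \<open>x\<close> of infinite
    measure. Hence \<open>h\<close> can be chosen freely for \<open>\<bar>x\<bar> \<le> n\<close>, subject to this bound, and equal to
    \<open>v(y)\<close> on \<open>y > 0\<close> for \<open>\<bar>x\<bar> > n\<close> (lemma \<open>exists_test_function\<close>).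
\<close>

section \<open>Distribution functions and the decreasing rearrangement\<close>

lemma ennreal_eq_top_if_of_nat_le:
  fixes c :: ennreal
  assumes "\<And>n::nat. of_nat n \<le> c"
  shows "c = top"
  by (meson assms ennreal_Ex_less_of_nat leD top.not_eq_extremum)

lemma emeasure_lborel_greaterThan: "emeasure lborel {c::real<..} = \<infinity>"
  unfolding infinity_ennreal_def
proof (rule ennreal_eq_top_if_of_nat_le)
  fix n :: nat
  have "of_nat n = emeasure lborel {c<..c + real n}"
    by (simp add: ennreal_of_nat_eq_real_of_nat)
  also have "\<dots> \<le> emeasure lborel {c<..}"
    by (rule emeasure_mono) auto
  finally show "of_nat n \<le> emeasure lborel {c<..}" .
qed

lemma emeasure_lborel_below:
  "emeasure lborel {a::real. 0 < a \<and> ennreal a < c} = c"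
proof (cases c)
  case (real r)
  then have "{a::real. 0 < a \<and> ennreal a < c} = {0<..<r}"
    by (auto simp: ennreal_less_iff)
  then show ?thesis using real by simp
next
  case top
  then have "{a::real. 0 < a \<and> ennreal a < c} = {0<..}"
    by auto
  then show ?thesis using top emeasure_lborel_greaterThan[of 0] by simp
qed

text \<open>
  A distribution function is right continuous in the level, so the infimum that defines the
  rearrangement is attained. All further facts about the rearrangement come from this Galois
  connection, which exchanges the strict superlevel sets of the rearrangement with those of the
  distribution function.
\<close>

lemma less_decr_rearr_iff:
  assumes [measurable]: "g \<in> borel_measurable borel"
  shows "l < decr_rearr g t \<longleftrightarrow> ennreal t < emeasure lborel {x. l < g x}"
proof
  assume "l < decr_rearr g t"
  then have "\<not> emeasure lebesgue {x. l < g x} \<le> ennreal t"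
    unfolding decr_rearr_def by (metis (mono_tags, lifting) Inf_lower leD mem_Collect_eq)
  then show "ennreal t < emeasure lborel {x. l < g x}"
    by simp
next
  assume less: "ennreal t < emeasure lborel {x. l < g x}"
  have "l \<noteq> top" using less by auto
  then have "{l<..} \<noteq> {}" using top.not_eq_extremum by auto
  then obtain u where u: "decseq u" "range u \<subseteq> {l<..}" "Inf {l<..} = (INF i. u i)"
    using ennreal_Inf_countable_INF by meson
  have "Inf {l<..} = l"
  proof (rule antisym)
    show "Inf {l<..} \<le> l"
      by (rule dense_ge) (auto intro: Inf_lower)
  qed (auto intro: Inf_greatest)
  then have lim: "u \<longlonglongrightarrow> l"
    using LIMSEQ_INF[OF u(1)] u(3) by simp
  have "(SUP i. emeasure lborel {x. u i < g x}) = emeasure lborel (\<Union>i. {x. u i < g x})"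
    by (rule SUP_emeasure_incseq) (use u(1) in \<open>auto simp: incseq_def decseq_def intro: le_less_trans\<close>)
  also have "(\<Union>i. {x. u i < g x}) = {x. l < g x}"
  proof safe
    fix x i assume "u i < g x" then show "l < g x" using u(2) less_trans[of l "u i" "g x"] by auto
  next
    fix x assume "l < g x"
    then have "eventually (\<lambda>i. u i < g x) sequentially"
      using lim by (rule order_tendstoD(2)[rotated])
    then show "x \<in> (\<Union>i. {x. u i < g x})" by (auto dest: eventually_happens)
  qed
  finally have "ennreal t < (SUP i. emeasure lborel {x. u i < g x})"
    using less by simp
  then obtain i where i: "ennreal t < emeasure lborel {x. u i < g x}"
    unfolding less_SUP_iff by blast
  have "u i \<le> decr_rearr g t"
    unfolding decr_rearr_def
  proof (rule Inf_greatest, rule ccontr)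
    fix k assume k: "k \<in> {l. emeasure lebesgue {x. l < g x} \<le> ennreal t}" "\<not> u i \<le> k"
    have "emeasure lborel {x. u i < g x} \<le> emeasure lborel {x. k < g x}"
      by (rule emeasure_mono) (use k(2) in auto)
    with i k show False by simp
  qed
  with u(2) show "l < decr_rearr g t" using less_le_trans[of l "u i"] by auto
qed

text \<open>
  Completeness of Lebesgue measure makes the superlevel sets of \<open>g\<close> measurable. The lemma serves to
  exchange a section of a Lebesgue measurable function on the plane for a Borel function.
\<close>

lemma decr_rearr_cong_AE:
  assumes [measurable]: "g' \<in> borel_measurable borel"
    and ae: "AE x in lborel. g x = g' x"
  shows "decr_rearr g t = decr_rearr g' t"
proof -
  have "emeasure lebesgue {x. l < g x} = emeasure lebesgue {x. l < g' x}" for l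
  proof -
    have ae': "AE x in lebesgue. g' x = g x"
      using AE_completion[OF ae] by eventually_elim simp
    have g': "{x. l < g' x} \<in> sets lebesgue" by (intro sets_completionI_sets) simp
    have "{x. l < g x} \<in> sets lebesgue"
      by (rule completion.in_sets_AE[OF _ g']) (use ae' in \<open>auto elim!: eventually_mono\<close>)
    then show ?thesis
      by (intro emeasure_eq_AE) (use ae' g' in \<open>auto elim!: eventually_mono\<close>)
  qed
  then show ?thesis by (simp add: decr_rearr_def)
qed

lemma decr_rearr_mono_distr:
  assumes [measurable]: "g \<in> borel_measurable borel" "k \<in> borel_measurable borel"
    and "\<And>l. emeasure lborel {x. l < g x} \<le> emeasure lborel {x. l < k x}"
  shows "decr_rearr g t \<le> decr_rearr k t"
proof (rule ccontr)
  assume "\<not> ?thesis"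
  then have "ennreal t < emeasure lborel {x. decr_rearr k t < g x}"
    using less_decr_rearr_iff[of g "decr_rearr k t" t] by (simp add: not_le)
  also have "\<dots> \<le> emeasure lborel {x. decr_rearr k t < k x}" by (rule assms)
  finally show False using less_decr_rearr_iff[of k "decr_rearr k t" t] by simp
qed

text \<open>
  By \<open>less_decr_rearr_iff\<close>, a superlevel set of the rearrangement is a region below a graph,
  namely that of the measure of the superlevel sets of the sections of \<open>F\<close>.
\<close>

lemma measurable_decr_rearr:
  assumes [measurable]: "(\<lambda>(x, y). F x y) \<in> borel_measurable (M \<Otimes>\<^sub>M borel)"
  shows "(\<lambda>(x, t). decr_rearr (F x) t) \<in> borel_measurable (M \<Otimes>\<^sub>M borel)"
proof -
  have "{p \<in> space (M \<Otimes>\<^sub>M borel). l < (case p of (x, t) \<Rightarrow> decr_rearr (F x) t)} \<in> sets (M \<Otimes>\<^sub>M borel)" for l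
  proof -
    let ?d = "\<lambda>x. emeasure lborel {y. l < F x y}"
    have F: "F x \<in> borel_measurable borel" if "x \<in> space M" for x
      using measurable_compose[OF measurable_Pair1'[OF that] assms] by simp
    have d [measurable]: "?d \<in> borel_measurable M"
    proof -
      have "{p \<in> space (M \<Otimes>\<^sub>M lborel). l < (\<lambda>(x, y). F x y) p} \<in> sets (M \<Otimes>\<^sub>M lborel)"
        by measurable
      from lborel.measurable_emeasure_Pair[OF this] show ?thesis
        by (subst measurable_cong) (auto simp: space_pair_measure intro!: arg_cong[of _ _ "emeasure lborel"])
    qed
    have iff: "l < decr_rearr (F x) t \<longleftrightarrow> ennreal t < ?d x" if "x \<in> space M" for x t
      by (rule less_decr_rearr_iff[OF F[OF that]])
    have "{p \<in> space (M \<Otimes>\<^sub>M borel). l < (case p of (x, t) \<Rightarrow> decr_rearr (F x) t)}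
        = {p \<in> space (M \<Otimes>\<^sub>M borel). ennreal (snd p) < ?d (fst p)}"
      using iff by (auto simp: space_pair_measure simp del: space_borel)
    also have "\<dots> \<in> sets (M \<Otimes>\<^sub>M borel)"
      by (intro borel_measurable_less measurable_compose[OF measurable_snd] measurable_compose[OF measurable_fst d]) measurable
    finally show ?thesis .
  qed
  then show ?thesis by (rule borel_measurableI_greater)
qed

lemma measurable_decr_rearr1 [measurable]:
  assumes [measurable]: "g \<in> borel_measurable borel"
  shows "decr_rearr g \<in> borel_measurable borel"
proof -
  have "(\<lambda>(x::real, t). decr_rearr g t) \<in> borel_measurable (borel \<Otimes>\<^sub>M borel)"
    by (rule measurable_decr_rearr) measurable
  from measurable_compose[OF measurable_Pair1'[of 0] this] show ?thesis by simp
qed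

text \<open>
  The superlevel set of a supremum is the increasing union of the superlevel sets, so its measure
  is the supremum of their measures.
\<close>

lemma decr_rearr_SUP:
  fixes g :: "nat \<Rightarrow> real \<Rightarrow> ennreal"
  assumes [measurable]: "\<And>n. g n \<in> borel_measurable borel"
    and inc: "incseq g"
  shows "decr_rearr (\<lambda>x. SUP n. g n x) t = (SUP n. decr_rearr (g n) t)"
proof -
  have "l < decr_rearr (\<lambda>x. SUP n. g n x) t \<longleftrightarrow> l < (SUP n. decr_rearr (g n) t)" for l
  proof -
    have "{x. l < (SUP n. g n x)} = (\<Union>n. {x. l < g n x})"
      by (auto simp: less_SUP_iff)
    moreover have "(SUP n. emeasure lborel {x. l < g n x}) = emeasure lborel (\<Union>n. {x. l < g n x})"
      by (rule SUP_emeasure_incseq)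
         (use inc in \<open>auto simp: incseq_def le_fun_def intro: less_le_trans\<close>)
    ultimately have "emeasure lborel {x. l < (SUP n. g n x)} = (SUP n. emeasure lborel {x. l < g n x})"
      by (simp only:)
    then have "l < decr_rearr (\<lambda>x. SUP n. g n x) t \<longleftrightarrow> ennreal t < (SUP n. emeasure lborel {x. l < g n x})"
      by (subst less_decr_rearr_iff) simp_all
    then show ?thesis
      by (simp only: less_SUP_iff less_decr_rearr_iff[OF assms(1)])
  qed
  from this[of "decr_rearr (\<lambda>x. SUP n. g n x) t"] this[of "SUP n. decr_rearr (g n) t"]
  show ?thesis by (simp only: less_irrefl not_less) (rule antisym; simp)
qed

lemma decr_rearr_antimono_le:
  fixes w :: "real \<Rightarrow> ennreal"
  assumes [measurable]: "w \<in> borel_measurable borel"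
    and anti: "\<And>s t. 0 < s \<Longrightarrow> s \<le> t \<Longrightarrow> w t \<le> w s" and zero: "\<And>t. t \<le> 0 \<Longrightarrow> w t = 0"
    and "0 < t"
  shows "decr_rearr w t \<le> w t"
proof (rule ccontr)
  assume "\<not> ?thesis"
  then have "ennreal t < emeasure lborel {s. w t < w s}"
    by (simp add: less_decr_rearr_iff not_le)
  also have "\<dots> \<le> emeasure lborel {0<..<t}"
    by (rule emeasure_mono) (use anti[of t] zero \<open>0 < t\<close> in \<open>force simp: not_less[symmetric]\<close>)+
  finally show False using \<open>0 < t\<close> by simp
qed

text \<open>
  The two functions can differ only at jumps of \<open>w\<close>. If a rational \<open>q\<close> lies in the jump at \<open>t\<close>,
  then no other point has a jump across \<open>q\<close>, so there are countably many.
\<close>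

lemma AE_decr_rearr_antimono:
  fixes w :: "real \<Rightarrow> ennreal"
  assumes [measurable]: "w \<in> borel_measurable borel"
    and anti: "\<And>s t. 0 < s \<Longrightarrow> s \<le> t \<Longrightarrow> w t \<le> w s" and zero: "\<And>t. t \<le> 0 \<Longrightarrow> w t = 0"
  shows "AE t in lborel. 0 < t \<longrightarrow> decr_rearr w t = w t"
proof -
  define E where "E q = {t. 0 < t \<and> decr_rearr w t < ennreal (of_rat q) \<and> ennreal (of_rat q) < w t}" for q
  have E1: "s = t" if st: "s \<in> E q" "t \<in> E q" "s \<le> t" for s t q
  proof (rule ccontr)
    assume "s \<noteq> t"
    have "ennreal t = emeasure lborel {0<..t}"
      using st by (simp add: E_def)
    also have "\<dots> \<le> emeasure lborel {u. ennreal (of_rat q) < w u}"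
      by (rule emeasure_mono) (use st anti[of _ t] in \<open>auto simp: E_def intro: less_le_trans\<close>)
    finally have "ennreal t \<le> emeasure lborel {u. ennreal (of_rat q) < w u}" .
    moreover have "ennreal s < ennreal t"
      using st \<open>s \<noteq> t\<close> by (simp add: ennreal_less_iff E_def)
    ultimately have "ennreal (of_rat q) < decr_rearr w s"
      by (subst less_decr_rearr_iff) auto
    moreover have "decr_rearr w s < ennreal (of_rat q)" using st by (simp add: E_def)
    ultimately show False by (rule less_asym)
  qed
  have "countable (E q)" for q
  proof (cases "E q = {}")
    case False
    then obtain s where "s \<in> E q" by auto
    then have "E q = {s}" using E1[of s q] E1[of _ q s] by (metis insertI1 linear singletonI subsetI subset_antisym singletonD empty_subsetI insert_subset)
    then show ?thesis by simp
  qed simp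
  then have "countable (\<Union>q. E q)" by auto
  then have "AE t in lborel. t \<notin> (\<Union>q. E q)"
    using countable_imp_null_set_lborel AE_not_in by blast
  then show ?thesis
  proof eventually_elim
    case (elim t)
    show ?case
    proof (intro impI antisym)
      assume t: "0 < t"
      then show "decr_rearr w t \<le> w t" by (intro decr_rearr_antimono_le assms)
      show "w t \<le> decr_rearr w t"
      proof (rule ccontr)
        assume "\<not> ?thesis"
        then obtain q where "decr_rearr w t < ennreal (real_of_rat q)" "ennreal (real_of_rat q) < w t"
          using ennreal_rat_dense[of "decr_rearr w t" "w t"] by (auto simp: not_le)
        then show False using elim t by (auto simp: E_def)
      qed
    qed
  qed
qed

section \<open>The layer cake formula and the Hardy-Littlewood inequality\<close>

text \<open>
  Write \<open>g x\<close> as the length of \<open>{a > 0. a < g x}\<close> and exchange the integrals. The weight \<open>h\<close> allows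
  the formula to be applied to both factors of a product in turn.
\<close>

lemma nn_integral_layer_cake:
  assumes "sigma_finite_measure M" and [measurable]: "g \<in> borel_measurable M" "h \<in> borel_measurable M"
  shows "(\<integral>\<^sup>+x. g x * h x \<partial>M) = (\<integral>\<^sup>+a\<in>{0<..}. (\<integral>\<^sup>+x. h x * indicator {x. ennreal a < g x} x \<partial>M) \<partial>lborel)"
proof -
  interpret pair_sigma_finite M lborel
    using assms(1) by (simp add: pair_sigma_finite_def sigma_finite_lborel)
  have "(\<integral>\<^sup>+x. g x * h x \<partial>M) = (\<integral>\<^sup>+x. (\<integral>\<^sup>+a. h x * indicator {a. 0 < a \<and> ennreal a < g x} a \<partial>lborel) \<partial>M)"
    by (intro nn_integral_cong) (simp add: nn_integral_cmult emeasure_lborel_below mult.commute)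
  also have "\<dots> = (\<integral>\<^sup>+x. (\<integral>\<^sup>+a. (\<lambda>(x, a). h x * (if 0 < a \<and> ennreal a < g x then 1 else 0)) (x, a) \<partial>lborel) \<partial>M)"
    by (intro nn_integral_cong) (auto simp: indicator_def)
  also have "\<dots> = (\<integral>\<^sup>+a. (\<integral>\<^sup>+x. (\<lambda>(x, a). h x * (if 0 < a \<and> ennreal a < g x then 1 else 0)) (x, a) \<partial>M) \<partial>lborel)"
    by (rule Fubini[symmetric]) measurable
  also have "\<dots> = (\<integral>\<^sup>+a\<in>{0<..}. (\<integral>\<^sup>+x. h x * indicator {x. ennreal a < g x} x \<partial>M) \<partial>lborel)"
    by (intro nn_integral_cong) (auto simp: indicator_def intro!: nn_integral_cong)
  finally show ?thesis .
qed

lemma nn_integral_layer_cake2: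
  assumes "sigma_finite_measure M" and [measurable]: "g \<in> borel_measurable M" "h \<in> borel_measurable M"
  shows "(\<integral>\<^sup>+x. g x * h x \<partial>M) =
    (\<integral>\<^sup>+a\<in>{0<..}. (\<integral>\<^sup>+b\<in>{0<..}. emeasure M {x \<in> space M. ennreal a < g x \<and> ennreal b < h x} \<partial>lborel) \<partial>lborel)"
proof -
  have "(\<integral>\<^sup>+x. h x * indicator {x. ennreal a < g x} x \<partial>M)
      = (\<integral>\<^sup>+b\<in>{0<..}. emeasure M {x \<in> space M. ennreal a < g x \<and> ennreal b < h x} \<partial>lborel)" for a
  proof -
    have ind: "(\<integral>\<^sup>+x. indicator {x. ennreal a < g x} x * indicator {x. ennreal b < h x} x \<partial>M)
        = emeasure M {x \<in> space M. ennreal a < g x \<and> ennreal b < h x}" for b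
    proof -
      have "(\<integral>\<^sup>+x. indicator {x. ennreal a < g x} x * indicator {x. ennreal b < h x} x \<partial>M)
        = (\<integral>\<^sup>+x. indicator {x \<in> space M. ennreal a < g x \<and> ennreal b < h x} x \<partial>M)"
        by (intro nn_integral_cong) (auto simp: indicator_def)
      then show ?thesis by simp
    qed
    have "(\<lambda>x. indicator {x. ennreal a < g x} x :: ennreal) \<in> borel_measurable M"
      unfolding indicator_def by measurable
    from nn_integral_layer_cake[OF assms(1,3) this] show ?thesis
      by (simp add: ind)
  qed
  then show ?thesis
    by (simp add: nn_integral_layer_cake[OF assms])
qed

text \<open>
  After two applications of the layer cake formula it remains to compare
  \<open>|{g > a} \<inter> {h > b}|\<close> with the same quantity for the rearrangements. By \<open>less_decr_rearr_iff\<close>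
  the superlevel sets of the latter are initial intervals of \<open>(0, \<infinity>)\<close>, and the smaller one is
  contained in the other.
\<close>

lemma hardy_littlewood:
  assumes [measurable]: "g \<in> borel_measurable borel" "h \<in> borel_measurable borel"
  shows "(\<integral>\<^sup>+x. g x * h x \<partial>lborel) \<le> (\<integral>\<^sup>+t\<in>{0<..}. decr_rearr g t * decr_rearr h t \<partial>lborel)"
proof -
  let ?L = "restrict_space lborel {0::real<..}"
  have sf: "sigma_finite_measure ?L"
    by (rule sigma_finite_measure_restrict_space[OF sigma_finite_lborel]) simp
  have eq: "emeasure ?L {t \<in> space ?L. l < decr_rearr g t \<and> k < decr_rearr h t}
      = min (emeasure lborel {x. l < g x}) (emeasure lborel {x. k < h x})" for l k
  proof -
    have "emeasure ?L {t \<in> space ?L. l < decr_rearr g t \<and> k < decr_rearr h t}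
      = emeasure lborel {t. 0 < t \<and> ennreal t < min (emeasure lborel {x. l < g x}) (emeasure lborel {x. k < h x})}"
      by (subst emeasure_restrict_space) (auto simp: less_decr_rearr_iff intro!: arg_cong[of _ _ "emeasure lborel"])
    then show ?thesis by (simp only: emeasure_lborel_below)
  qed
  have "(\<integral>\<^sup>+x. g x * h x \<partial>lborel)
    = (\<integral>\<^sup>+a\<in>{0<..}. (\<integral>\<^sup>+b\<in>{0<..}. emeasure lborel {x. ennreal a < g x \<and> ennreal b < h x} \<partial>lborel) \<partial>lborel)"
    by (subst nn_integral_layer_cake2[OF sigma_finite_lborel]) auto
  also have "\<dots> \<le> (\<integral>\<^sup>+a\<in>{0<..}. (\<integral>\<^sup>+b\<in>{0<..}. emeasure ?L
      {t \<in> space ?L. ennreal a < decr_rearr g t \<and> ennreal b < decr_rearr h t} \<partial>lborel) \<partial>lborel)"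
    unfolding eq by (intro nn_integral_mono mult_right_mono min.boundedI emeasure_mono) auto
  also have "\<dots> = (\<integral>\<^sup>+t. decr_rearr g t * decr_rearr h t \<partial>?L)"
    by (rule nn_integral_layer_cake2[OF sf, symmetric]) (auto intro!: measurable_restrict_space1)
  also have "\<dots> = (\<integral>\<^sup>+t\<in>{0<..}. decr_rearr g t * decr_rearr h t \<partial>lborel)"
    by (subst nn_integral_restrict_space) auto
  finally show ?thesis .
qed

lemma nn_integral_decr_rearr:
  assumes [measurable]: "g \<in> borel_measurable borel"
  shows "(\<integral>\<^sup>+t\<in>{0<..}. decr_rearr g t \<partial>lborel) = (\<integral>\<^sup>+x. g x \<partial>lborel)"
proof -
  have "(\<integral>\<^sup>+t\<in>{0<..}. decr_rearr g t \<partial>lborel)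
    = (\<integral>\<^sup>+a\<in>{0<..}. (\<integral>\<^sup>+t. indicator {0<..} t * indicator {t. ennreal a < decr_rearr g t} t \<partial>lborel) \<partial>lborel)"
    by (rule nn_integral_layer_cake[OF sigma_finite_lborel]) auto
  also have "\<dots> = (\<integral>\<^sup>+a\<in>{0<..}. emeasure lborel {x. ennreal a < g x} \<partial>lborel)"
  proof -
    have "(\<integral>\<^sup>+t. indicator {0<..} t * indicator {t. l < decr_rearr g t} t \<partial>lborel)
      = emeasure lborel {x. l < g x}" for l
    proof -
      have "(\<integral>\<^sup>+t. indicator {0<..} t * indicator {t. l < decr_rearr g t} t \<partial>lborel)
        = (\<integral>\<^sup>+t. indicator {t. 0 < t \<and> ennreal t < emeasure lborel {x. l < g x}} t \<partial>lborel)"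
        by (intro nn_integral_cong) (auto simp: indicator_def less_decr_rearr_iff)
      then show ?thesis by (simp add: emeasure_lborel_below)
    qed
    then show ?thesis by simp
  qed
  also have "\<dots> = (\<integral>\<^sup>+x. g x * 1 \<partial>lborel)"
    by (subst nn_integral_layer_cake[OF sigma_finite_lborel]) auto
  finally show ?thesis by simp
qed

section \<open>Ranking points by a function without flat parts\<close>

text \<open>
  The set \<open>S\<close> of points of rank at most \<open>a\<close> contains, with each point, all points where \<open>G\<close> is
  larger. Choosing points of \<open>S\<close> along which \<open>G\<close> decreases to its infimum on \<open>S\<close> exhausts \<open>S\<close> by
  superlevel sets of measure at most \<open>a\<close>, up to the level set of the infimum, which is null.
\<close>

lemma (in finite_measure) measure_superlevel_rank_le:
  fixes G :: "'a \<Rightarrow> real"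
  assumes [measurable]: "G \<in> borel_measurable M"
    and null: "\<And>c. measure M {z \<in> space M. G z = c} = 0"
    and "0 \<le> a"
  shows "measure M {y \<in> space M. measure M {z \<in> space M. G y < G z} \<le> a} \<le> a"
proof (cases "{y \<in> space M. measure M {z \<in> space M. G y < G z} \<le> a} = {}")
  case False
  define S where "S = {y \<in> space M. measure M {z \<in> space M. G y < G z} \<le> a}"
  with False have "(\<lambda>y. ereal (G y)) ` S \<noteq> {}" by auto
  then obtain u where u: "decseq u" "range u \<subseteq> (\<lambda>y. ereal (G y)) ` S"
      "Inf ((\<lambda>y. ereal (G y)) ` S) = (INF i. u i)"
    using Inf_countable_INF by meson
  define A where "A i = {z \<in> space M. u i < ereal (G z)}" for i
  have [measurable]: "A i \<in> sets M" for i unfolding A_def by measurable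
  have Aa: "measure M (A i) \<le> a" for i
  proof -
    obtain y where "y \<in> S" "u i = ereal (G y)" using u(2) by auto
    then show ?thesis by (simp add: A_def S_def)
  qed
  have "incseq A"
    using u(1) by (force simp: A_def incseq_def decseq_def intro: le_less_trans)
  then have "(\<lambda>i. measure M (A i)) \<longlonglongrightarrow> measure M (\<Union>i. A i)"
    by (intro finite_Lim_measure_incseq) auto
  then have Ua: "measure M (\<Union>i. A i) \<le> a"
    by (rule LIMSEQ_le_const2) (use Aa in auto)
  let ?N = "{z \<in> space M. ereal (G z) = (INF i. u i)}"
  have N0: "measure M ?N = 0"
    using null by (cases "INF i. u i") auto
  have "S \<subseteq> (\<Union>i. A i) \<union> ?N"
  proof
    fix y assume y: "y \<in> S"
    then have "(INF i. u i) \<le> ereal (G y)"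
      unfolding u(3)[symmetric] by (intro Inf_lower) auto
    then consider "ereal (G y) = (INF i. u i)" | "(INF i. u i) < ereal (G y)" by fastforce
    then show "y \<in> (\<Union>i. A i) \<union> ?N"
      using y by cases (auto simp: INF_less_iff A_def S_def)
  qed
  then have "measure M S \<le> measure M ((\<Union>i. A i) \<union> ?N)"
    by (intro finite_measure_mono) auto
  also have "\<dots> \<le> measure M (\<Union>i. A i) + measure M ?N"
    by (intro measure_Un_le) auto
  finally show ?thesis using Ua N0 by (simp add: S_def)
next
  case True
  then show ?thesis using \<open>0 \<le> a\<close> by (simp only: measure_empty)
qed

text \<open>
  The probability integral transform for an atomless distribution. One half of it is
  \<open>measure_superlevel_rank_le\<close>. The other half is the same lemma for \<open>- G\<close>, because reversing the
  order replaces the rank by its complement to the total mass.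
\<close>

lemma (in finite_measure) distr_superlevel_rank:
  fixes G :: "'a \<Rightarrow> real"
  assumes [measurable]: "G \<in> borel_measurable M"
    and null: "\<And>c. measure M {z \<in> space M. G z = c} = 0"
    and [measurable]: "(\<lambda>y. measure M {z \<in> space M. G y < G z}) \<in> borel_measurable M"
  shows "distr M borel (\<lambda>y. measure M {z \<in> space M. G y < G z})
    = density lborel (indicator {0<..<measure M (space M)})"
proof (rule measure_eqI_lessThan)
  define m where "m = measure M (space M)"
  define r where "r y = measure M {z \<in> space M. G y < G z}" for y
  have [measurable]: "r \<in> borel_measurable M" unfolding r_def by measurable
  have r: "0 \<le> r y" "r y \<le> m" for y
    by (auto simp: r_def m_def intro!: finite_measure_mono)
  have r_le: "measure M {y \<in> space M. r y \<le> a} \<le> a" if "0 \<le> a" for a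
    unfolding r_def by (rule measure_superlevel_rank_le) (use that null in auto)
  have r_ge: "measure M {y \<in> space M. m - a \<le> r y} \<le> a" if "0 \<le> a" for a
  proof -
    have null': "measure M {z \<in> space M. - G z = c} = 0" for c
    proof -
      have "- G z = c \<longleftrightarrow> G z = - c" for z by auto
      then show ?thesis using null[of "- c"] by simp
    qed
    have rank_neg: "measure M {z \<in> space M. - G y < - G z} = m - r y" for y
    proof -
      have "m = measure M ({z \<in> space M. G z < G y} \<union> {z \<in> space M. G z = G y} \<union> {z \<in> space M. G y < G z})"
        unfolding m_def by (rule arg_cong[of _ _ "measure M"]) auto
      also have "\<dots> = measure M {z \<in> space M. G z < G y} + measure M {z \<in> space M. G z = G y} + r y"
        unfolding r_def by (simp add: finite_measure_Union disjoint_iff)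
      finally show ?thesis by (simp add: null)
    qed
    have "measure M {y \<in> space M. measure M {z \<in> space M. - G y < - G z} \<le> a} \<le> a"
      by (rule measure_superlevel_rank_le) (use that null' in auto)
    moreover have "m - r y \<le> a \<longleftrightarrow> m - a \<le> r y" for y by linarith
    ultimately show ?thesis unfolding rank_neg by (simp only:)
  qed
  fix c :: real
  have "measure M {y \<in> space M. c < r y} = max 0 (m - max 0 c)"
  proof -
    consider "c < 0" | "m \<le> c" "0 \<le> c" | "0 \<le> c" "c < m" by linarith
    then show ?thesis
    proof cases
      case 1
      then have "{y \<in> space M. c < r y} = space M" using r(1) by (auto intro: less_le_trans)
      then show ?thesis using 1 by (simp add: m_def)
    next
      case 2
      then have "{y \<in> space M. c < r y} = {}" using r(2) by (auto simp: not_less intro: order_trans)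
      then have "measure M {y \<in> space M. c < r y} = 0" by (simp only: measure_empty)
      then show ?thesis using 2 by simp
    next
      case 3
      have "measure M {y \<in> space M. c < r y} \<le> measure M {y \<in> space M. m - (m - c) \<le> r y}"
        by (intro finite_measure_mono) auto
      also have "\<dots> \<le> m - c" using 3 by (intro r_ge) auto
      finally have le: "measure M {y \<in> space M. c < r y} \<le> m - c" .
      have "m = measure M ({y \<in> space M. c < r y} \<union> {y \<in> space M. r y \<le> c})"
        unfolding m_def by (rule arg_cong[of _ _ "measure M"]) auto
      also have "\<dots> \<le> measure M {y \<in> space M. c < r y} + c"
        using r_le[of c] 3 by (subst finite_measure_Union) auto
      finally show ?thesis using le 3 by simp
    qed
  qed
  then have eq: "emeasure (distr M borel r) {c<..} = ennreal (max 0 (m - max 0 c))"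
    by (simp add: emeasure_distr emeasure_eq_measure vimage_def Int_def conj_commute)
  have "emeasure (density lborel (indicator {0<..<m})) {c<..}
      = (\<integral>\<^sup>+t. indicator {0<..<m} t * indicator {c<..} t \<partial>lborel)"
    by (subst emeasure_density) auto
  also have "\<dots> = (\<integral>\<^sup>+t. indicator {max 0 c<..<max m (max 0 c)} t \<partial>lborel)"
    by (intro nn_integral_cong) (auto split: split_indicator)
  also have "\<dots> = ennreal (max 0 (m - max 0 c))"
    by (subst nn_integral_indicator) (auto simp: max_def)
  finally show "emeasure (distr M borel (\<lambda>y. measure M {z \<in> space M. G y < G z})) {c<..}
      = emeasure (density lborel (indicator {0<..<measure M (space M)})) {c<..}"
    using eq by (simp add: r_def[abs_def] m_def)
  show "emeasure (distr M borel (\<lambda>y. measure M {z \<in> space M. G y < G z})) {c<..} < \<infinity>"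
    using eq by (simp add: r_def[abs_def])
qed auto

section \<open>Measurable ranking of the sections of a plane function\<close>

text \<open>
  The lexicographic order by \<open>k\<close> and then by position, encoded in one real number: on \<open>[-R,R]\<close> the
  second summand increases from \<open>0\<close> to a value below \<open>1\<close>, and distinct values of \<open>k\<close> differ by at
  least \<open>1\<close>. The denominator \<open>2 * R + 1\<close> also covers \<open>R = 0\<close>.
\<close>

definition tie_break :: "real \<Rightarrow> (real \<Rightarrow> int) \<Rightarrow> real \<Rightarrow> real" where
  "tie_break R k y = of_int (k y) + (y + R) / (2 * R + 1)"

definition rearr_rank :: "real \<Rightarrow> (real \<Rightarrow> int) \<Rightarrow> real \<Rightarrow> real" where
  "rearr_rank R k y = measure lborel {z \<in> {-R..R}. tie_break R k y < tie_break R k z}"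

lemma tie_break_less:
  assumes "k y < k z" "y \<in> {-R..R}" "z \<in> {-R..R}"
  shows "tie_break R k y < tie_break R k z"
proof -
  have "(y + R) / (2 * R + 1) < 1" "0 \<le> (z + R) / (2 * R + 1)"
    using assms by (auto simp: divide_simps)
  moreover have "real_of_int (k y) + 1 \<le> real_of_int (k z)"
    using assms(1) by linarith
  ultimately show ?thesis by (simp add: tie_break_def)
qed

lemma tie_break_inj:
  assumes "0 \<le> R"
  shows "inj_on (tie_break R k) {-R..R}"
proof (rule inj_onI)
  fix y z assume yz: "y \<in> {-R..R}" "z \<in> {-R..R}" "tie_break R k y = tie_break R k z"
  then have "k y = k z"
    using tie_break_less[of k y z R] tie_break_less[of k z y R] by (cases "k y" "k z" rule: linorder_cases) auto
  then show "y = z" using yz assms by (simp add: tie_break_def)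
qed

lemma measurable_tie_break:
  fixes k :: "real \<Rightarrow> real \<Rightarrow> int"
  assumes [measurable]: "(\<lambda>(x, y). real_of_int (k x y)) \<in> borel_measurable borel"
    "a \<in> borel_measurable M" "b \<in> borel_measurable M"
  shows "(\<lambda>p. tie_break R (k (a p)) (b p)) \<in> borel_measurable M"
proof -
  have "(\<lambda>p. (\<lambda>(x, y). real_of_int (k x y)) (a p, b p)) \<in> borel_measurable M"
    by (rule measurable_compose[OF measurable_Pair[OF assms(2,3), unfolded borel_prod] assms(1)])
  then show ?thesis unfolding tie_break_def by simp
qed

lemma measurable_rearr_rank:
  fixes k :: "real \<Rightarrow> real \<Rightarrow> int"
  assumes k: "(\<lambda>(x, y). real_of_int (k x y)) \<in> borel_measurable borel"
  shows "(\<lambda>(x, y). rearr_rank R (k x) y) \<in> borel_measurable borel"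
proof -
  have [measurable]:
    "(\<lambda>q. tie_break R (k (fst (fst q))) (snd (fst q))) \<in> borel_measurable ((borel \<Otimes>\<^sub>M borel) \<Otimes>\<^sub>M lborel)"
    "(\<lambda>q. tie_break R (k (fst (fst q))) (snd q)) \<in> borel_measurable ((borel \<Otimes>\<^sub>M borel) \<Otimes>\<^sub>M lborel)"
    by (rule measurable_tie_break[OF k]; measurable)+
  define S where "S = {q \<in> space ((borel :: (real \<times> real) measure) \<Otimes>\<^sub>M (lborel :: real measure)).
    snd q \<in> {-R..R} \<and> tie_break R (k (fst (fst q))) (snd (fst q)) < tie_break R (k (fst (fst q))) (snd q)}"
  have "S \<in> sets ((borel :: (real \<times> real) measure) \<Otimes>\<^sub>M lborel)"
    unfolding S_def borel_prod[symmetric] by measurable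
  then have "(\<lambda>p. emeasure lborel (Pair p -` S)) \<in> borel_measurable borel"
    by (rule lborel.measurable_emeasure_Pair)
  then have "(\<lambda>p. enn2real (emeasure lborel (Pair p -` S))) \<in> borel_measurable borel"
    by simp
  moreover have "Pair (x, y) -` S = {z \<in> {-R..R}. tie_break R (k x) y < tie_break R (k x) z}" for x y
    by (auto simp: S_def space_pair_measure)
  then have "enn2real (emeasure lborel (Pair (x, y) -` S)) = rearr_rank R (k x) y" for x y
    by (simp only: rearr_rank_def measure_def)
  then have "(\<lambda>(x, y). rearr_rank R (k x) y) = (\<lambda>p. enn2real (emeasure lborel (Pair p -` S)))"
    by (intro ext) (simp only: split_paired_all prod.case)
  ultimately show ?thesis by (simp only:)
qed

lemma measurable_rearr_rank1 [measurable]: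
  assumes "(\<lambda>y. real_of_int (k y)) \<in> borel_measurable borel"
  shows "rearr_rank R k \<in> borel_measurable borel"
proof -
  have "(\<lambda>(x::real, y). real_of_int (k y)) \<in> borel_measurable borel"
    using assms by (simp flip: borel_prod)
  from measurable_rearr_rank[OF this] have "(\<lambda>(x::real, y). rearr_rank R k y) \<in> borel_measurable (borel \<Otimes>\<^sub>M borel)"
    by (simp add: borel_prod)
  from measurable_compose[OF measurable_Pair1'[of 0] this] show ?thesis by simp
qed

text \<open>
  Injectivity of \<open>tie_break\<close> makes all its level sets null, so the rank maps Lebesgue measure on
  \<open>[-R,R]\<close> to Lebesgue measure on \<open>(0, 2 R)\<close>.
\<close>

lemma nn_integral_rearr_rank:
  assumes "0 \<le> R" and k: "(\<lambda>y. real_of_int (k y)) \<in> borel_measurable borel"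
    and [measurable]: "w \<in> borel_measurable borel"
  shows "(\<integral>\<^sup>+y\<in>{-R..R}. w (rearr_rank R k y) \<partial>lborel) = (\<integral>\<^sup>+t\<in>{0<..<2 * R}. w t \<partial>lborel)"
proof -
  let ?M = "restrict_space lborel {-R..R}"
  interpret finite_measure ?M
    by (rule finite_measureI) (simp add: space_restrict_space emeasure_restrict_space emeasure_lborel_Icc_eq)
  note [measurable] = measurable_rearr_rank1[OF k]
  have [measurable]: "tie_break R k \<in> borel_measurable borel"
    using k unfolding tie_break_def[abs_def] by measurable
  have M: "measure ?M A = measure lborel A" if "A \<subseteq> {-R..R}" for A
    using that by (intro measure_restrict_space) auto
  have rank: "measure ?M {z \<in> space ?M. tie_break R k y < tie_break R k z} = rearr_rank R k y" for y
    unfolding rearr_rank_def by (subst M) (auto simp: space_restrict_space)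
  have tb: "tie_break R k \<in> borel_measurable ?M" "rearr_rank R k \<in> borel_measurable ?M"
    by (auto intro!: measurable_restrict_space1)
  have null: "measure ?M {z \<in> space ?M. tie_break R k z = c} = 0" for c
  proof -
    have "finite {z \<in> {-R..R}. tie_break R k z = c}"
      using finite_vimage_IntI[OF _ tie_break_inj[OF assms(1)], of "{c}" k]
      by (simp add: vimage_def Int_def conj_commute)
    then have "emeasure lborel {z \<in> {-R..R}. tie_break R k z = c} = 0"
      by (intro emeasure_lborel_countable countable_finite)
    then show ?thesis by (subst M) (auto simp: measure_def space_restrict_space)
  qed
  have "measure ?M (space ?M) = 2 * R"
    using assms(1) by (subst M) (auto simp: space_restrict_space)
  then have distr: "distr ?M borel (rearr_rank R k) = density lborel (indicator {0<..<2 * R})"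
    using distr_superlevel_rank[OF tb(1) null] tb(2) unfolding rank by simp
  have "(\<integral>\<^sup>+y\<in>{-R..R}. w (rearr_rank R k y) \<partial>lborel) = (\<integral>\<^sup>+y. w (rearr_rank R k y) \<partial>?M)"
    by (subst nn_integral_restrict_space) auto
  also have "\<dots> = (\<integral>\<^sup>+t. w t \<partial>distr ?M borel (rearr_rank R k))"
    using tb by (subst nn_integral_distr) auto
  also have "\<dots> = (\<integral>\<^sup>+t\<in>{0<..<2 * R}. w t \<partial>lborel)"
    unfolding distr by (subst nn_integral_density) (auto simp: mult.commute)
  finally show ?thesis .
qed

text \<open>
  Arranging \<open>w\<close> in the order of \<open>k\<close> reaches the Hardy-Littlewood bound. By the transport property of
  the rank it suffices that the rearrangement, evaluated at the rank of \<open>y\<close>, is at most the value at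
  \<open>y\<close>: the points with a larger value all come before \<open>y\<close>, so their measure is at most the rank.
\<close>

lemma nn_integral_decr_rearr_rank_le:
  fixes k :: "real \<Rightarrow> int"
  assumes "0 \<le> R" "0 < c" and k: "(\<lambda>y. real_of_int (k y)) \<in> borel_measurable borel"
    and [measurable]: "w \<in> borel_measurable borel"
  shows "(\<integral>\<^sup>+t\<in>{0<..}. decr_rearr (\<lambda>y. ennreal (k y / c) * indicator {-R..R} y) t * w t \<partial>lborel)
    \<le> (\<integral>\<^sup>+y\<in>{-R..R}. ennreal (k y / c) * w (rearr_rank R k y) \<partial>lborel)"
proof -
  note [measurable] = k
  define D where "D = decr_rearr (\<lambda>y. ennreal (k y / c) * indicator {-R..R} y)"
  have [measurable]: "D \<in> borel_measurable borel"
    unfolding D_def by measurable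
  \<comment> \<open>The rearranged function is supported in an interval of length \<open>2 R\<close>.\<close>
  have D0: "D t = 0" if "2 * R \<le> t" for t
  proof (rule ccontr)
    assume "D t \<noteq> 0"
    then have "ennreal t < emeasure lborel {y. 0 < ennreal (k y / c) * indicator {-R..R} y}"
      unfolding D_def by (subst less_decr_rearr_iff[symmetric]) (auto simp: zero_less_iff_neq_zero)
    also have "\<dots> \<le> emeasure lborel {-R..R}"
      by (rule emeasure_mono) (auto simp: indicator_def)
    also have "\<dots> \<le> ennreal t" using that assms(1) by (simp add: ennreal_leI)
    finally show False by simp
  qed
  have D_rank: "D (rearr_rank R k y) \<le> ennreal (k y / c)" if y: "y \<in> {-R..R}" for y
  proof (rule ccontr)
    assume "\<not> ?thesis"
    then have "ennreal (rearr_rank R k y) < emeasure lborel {z. ennreal (k y / c) < ennreal (k z / c) * indicator {-R..R} z}"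
      unfolding D_def not_le by (subst less_decr_rearr_iff[symmetric]) auto
    also have "\<dots> \<le> emeasure lborel {z \<in> {-R..R}. tie_break R k y < tie_break R k z}"
    proof (rule emeasure_mono)
      show "{z. ennreal (k y / c) < ennreal (k z / c) * indicator {-R..R} z}
        \<subseteq> {z \<in> {-R..R}. tie_break R k y < tie_break R k z}"
      proof safe
        fix z assume z: "ennreal (k y / c) < ennreal (k z / c) * indicator {-R..R} z"
        then show zR: "z \<in> {-R..R}" by (cases "z \<in> {-R..R}") auto
        with z have "k y / c < k z / c" 
          by (metis ennreal_leI indicator_simps(1) leI leD mult.right_neutral)
        then have "k y < k z" using \<open>0 < c\<close> by (simp add: divide_less_cancel)
        then show "tie_break R k y < tie_break R k z" using y zR by (rule tie_break_less)
      qed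
      show "{z \<in> {-R..R}. tie_break R k y < tie_break R k z} \<in> sets lborel"
        using k unfolding tie_break_def by measurable
    qed
    also have "\<dots> = ennreal (rearr_rank R k y)"
    proof -
      have "emeasure lborel {z \<in> {-R..R}. tie_break R k y < tie_break R k z} \<le> emeasure lborel {-R..R}"
        by (rule emeasure_mono) auto
      also have "\<dots> < \<infinity>" by (simp add: emeasure_lborel_Icc_eq)
      finally show ?thesis unfolding rearr_rank_def by (intro emeasure_eq_ennreal_measure) auto
    qed
    finally show False by simp
  qed
  have "(\<integral>\<^sup>+t\<in>{0<..}. D t * w t \<partial>lborel) = (\<integral>\<^sup>+t\<in>{0<..<2 * R}. D t * w t \<partial>lborel)"
    using D0 by (intro nn_integral_cong) (auto simp: indicator_def not_less)
  also have "\<dots> = (\<integral>\<^sup>+y\<in>{-R..R}. D (rearr_rank R k y) * w (rearr_rank R k y) \<partial>lborel)"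
    using nn_integral_rearr_rank[OF assms(1) k, of "\<lambda>t. D t * w t"] by simp
  also have "\<dots> \<le> (\<integral>\<^sup>+y\<in>{-R..R}. ennreal (k y / c) * w (rearr_rank R k y) \<partial>lborel)"
    by (intro nn_integral_mono) (auto simp: indicator_def intro!: mult_right_mono D_rank)
  finally show ?thesis unfolding D_def .
qed

lemma decr_rearr_rank_le:
  fixes w :: "real \<Rightarrow> ennreal"
  assumes "0 \<le> R" and k: "(\<lambda>y. real_of_int (k y)) \<in> borel_measurable borel"
    and [measurable]: "w \<in> borel_measurable borel"
  shows "decr_rearr (\<lambda>y. w (rearr_rank R k y) * indicator {-R..R} y) t \<le> decr_rearr w t"
proof (rule decr_rearr_mono_distr)
  note [measurable] = measurable_rearr_rank1[OF k]
  show "(\<lambda>y. w (rearr_rank R k y) * indicator {-R..R} y) \<in> borel_measurable borel" by measurable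
  fix l
  have "emeasure lborel {y. l < w (rearr_rank R k y) * indicator {-R..R} y}
      = (\<integral>\<^sup>+y. indicator {y. l < w (rearr_rank R k y) * indicator {-R..R} y} y \<partial>lborel)"
    by simp
  also have "\<dots> = (\<integral>\<^sup>+y\<in>{-R..R}. (if l < w (rearr_rank R k y) then 1 else 0) \<partial>lborel)"
    by (intro nn_integral_cong) (auto split: split_indicator)
  also have "\<dots> = (\<integral>\<^sup>+t\<in>{0<..<2 * R}. (if l < w t then 1 else 0) \<partial>lborel)"
    using nn_integral_rearr_rank[OF assms(1) k, of "\<lambda>t. if l < w t then 1 else 0"] by simp
  also have "\<dots> \<le> (\<integral>\<^sup>+t. indicator {t. l < w t} t \<partial>lborel)"
    by (intro nn_integral_mono) (auto simp: indicator_def)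
  also have "\<dots> = emeasure lborel {t. l < w t}" by simp
  finally show "emeasure lborel {y. l < w (rearr_rank R k y) * indicator {-R..R} y} \<le> emeasure lborel {t. l < w t}" .
qed simp

section \<open>Dyadic truncations\<close>

definition dyadic_floor :: "nat \<Rightarrow> real \<Rightarrow> real" where
  "dyadic_floor n r = of_int \<lfloor>2 ^ n * r\<rfloor> / 2 ^ n"

lemma dyadic_floor_le: "dyadic_floor n r \<le> r"
  by (simp add: dyadic_floor_def pos_divide_le_eq mult.commute)

lemma dyadic_floor_mono: "m \<le> n \<Longrightarrow> dyadic_floor m r \<le> dyadic_floor n r"
proof (induction rule: dec_induct)
  case (step n)
  have "2 * \<lfloor>2 ^ n * r\<rfloor> \<le> \<lfloor>2 ^ Suc n * r\<rfloor>"
    unfolding le_floor_iff by simp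
  then have "2 * real_of_int \<lfloor>2 ^ n * r\<rfloor> \<le> real_of_int \<lfloor>2 ^ Suc n * r\<rfloor>"
    by linarith
  then have "dyadic_floor n r \<le> dyadic_floor (Suc n) r"
    by (simp add: dyadic_floor_def field_simps)
  with step.IH show ?case by simp
qed simp

lemma dyadic_floor_tendsto: "(\<lambda>n. dyadic_floor n r) \<longlonglongrightarrow> r"
proof (rule tendsto_sandwich[where h = "\<lambda>_. r"])
  show "\<forall>\<^sub>F n in sequentially. r - (1 / 2) ^ n \<le> dyadic_floor n r"
  proof (intro always_eventually allI)
    fix n
    have "2 ^ n * r - 1 \<le> real_of_int \<lfloor>2 ^ n * r\<rfloor>" by linarith
    then have "(2 ^ n * r - 1) / 2 ^ n \<le> dyadic_floor n r"
      unfolding dyadic_floor_def by (intro divide_right_mono) auto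
    then show "r - (1 / 2) ^ n \<le> dyadic_floor n r"
      by (simp add: diff_divide_distrib power_one_over inverse_eq_divide)
  qed
  have "(\<lambda>n. r - (1 / 2) ^ n) \<longlonglongrightarrow> r - 0"
    by (intro tendsto_diff tendsto_const LIMSEQ_realpow_zero) auto
  then show "(\<lambda>n. r - (1 / 2) ^ n) \<longlonglongrightarrow> r" by simp
qed (auto simp: dyadic_floor_le intro!: always_eventually)

lemma dyadic_truncation_incseq:
  "incseq (\<lambda>n. ennreal (dyadic_floor n r) * indicator {-real n..real n} y)"
  by (intro incseq_SucI mult_mono ennreal_leI dyadic_floor_mono) (auto split: split_indicator)

lemma dyadic_truncation_SUP:
  "(SUP n. ennreal (dyadic_floor n r) * indicator {-real n..real n} y) = ennreal r"
proof (rule LIMSEQ_unique[OF LIMSEQ_SUP[OF dyadic_truncation_incseq]])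
  have "\<forall>\<^sub>F n in sequentially. \<bar>y\<bar> \<le> real n"
    using eventually_ge_at_top[of "nat \<lceil>\<bar>y\<bar>\<rceil>"] by eventually_elim linarith
  then have "\<forall>\<^sub>F n in sequentially. ennreal (dyadic_floor n r)
      = ennreal (dyadic_floor n r) * indicator {-real n..real n} y"
    by eventually_elim (auto split: split_indicator)
  then show "(\<lambda>n. ennreal (dyadic_floor n r) * indicator {-real n..real n} y) \<longlonglongrightarrow> ennreal r"
    by (rule Lim_transform_eventually[rotated]) (intro tendsto_ennrealI dyadic_floor_tendsto)
qed

section \<open>The iterated rearrangement\<close>

lemma measurable_section:
  fixes F :: "real \<Rightarrow> real \<Rightarrow> 'b::topological_space"
  assumes "(\<lambda>(x, y). F x y) \<in> borel_measurable borel"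
  shows "F x \<in> borel_measurable borel"
proof -
  have "(\<lambda>(x, y). F x y) \<in> borel_measurable (borel \<Otimes>\<^sub>M borel)"
    using assms by (simp add: borel_prod)
  from measurable_compose[OF measurable_Pair1'[of x] this] show ?thesis by simp
qed

lemma measurable_swap_curried:
  fixes F :: "real \<Rightarrow> real \<Rightarrow> 'b::topological_space"
  assumes "(\<lambda>(x, y). F x y) \<in> borel_measurable borel"
  shows "(\<lambda>(y, x). F x y) \<in> borel_measurable borel"
proof -
  have "(\<lambda>(x, y). F x y) \<in> borel_measurable (borel \<Otimes>\<^sub>M borel)"
    using assms by (simp add: borel_prod)
  from measurable_pair_swap[OF this] show ?thesis
    by (simp add: borel_prod)
qed

lemma measurable_decr_rearr_section:
  fixes F :: "real \<Rightarrow> real \<Rightarrow> ennreal"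
  assumes "(\<lambda>(x, y). F x y) \<in> borel_measurable borel"
  shows "(\<lambda>(x, t). decr_rearr (F x) t) \<in> borel_measurable borel"
  using measurable_decr_rearr[of F borel] assms by (simp add: borel_prod)

lemma measurable_iterated_rearr:
  fixes F :: "real \<Rightarrow> real \<Rightarrow> ennreal"
  assumes "(\<lambda>(x, y). F x y) \<in> borel_measurable borel"
  shows "(\<lambda>(s, t). decr_rearr (\<lambda>x. decr_rearr (F x) t) s) \<in> borel_measurable borel"
  by (rule measurable_swap_curried[OF measurable_decr_rearr_section[OF
        measurable_swap_curried[OF measurable_decr_rearr_section[OF assms]]]])

lemma nn_integral_lborel_prod:
  fixes G :: "real \<Rightarrow> real \<Rightarrow> ennreal"
  assumes "(\<lambda>(x, y). G x y) \<in> borel_measurable borel"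
  shows "(\<integral>\<^sup>+x. (\<integral>\<^sup>+y. G x y \<partial>lborel) \<partial>lborel) = (\<integral>\<^sup>+(x, y). G x y \<partial>lborel)"
    and "(\<integral>\<^sup>+y. (\<integral>\<^sup>+x. G x y \<partial>lborel) \<partial>lborel) = (\<integral>\<^sup>+(x, y). G x y \<partial>lborel)"
proof -
  have "(\<lambda>(x, y). G x y) \<in> borel_measurable (lborel \<Otimes>\<^sub>M lborel)"
    using assms by (simp add: lborel_prod)
  from lborel.nn_integral_fst[OF this] lborel_pair.nn_integral_snd[OF this]
  show "(\<integral>\<^sup>+x. (\<integral>\<^sup>+y. G x y \<partial>lborel) \<partial>lborel) = (\<integral>\<^sup>+(x, y). G x y \<partial>lborel)"
    and "(\<integral>\<^sup>+y. (\<integral>\<^sup>+x. G x y \<partial>lborel) \<partial>lborel) = (\<integral>\<^sup>+(x, y). G x y \<partial>lborel)"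
    by (simp_all add: lborel_prod)
qed

lemma nn_integral_pos_quadrant:
  fixes G :: "real \<Rightarrow> real \<Rightarrow> ennreal"
  assumes G: "(\<lambda>(s, t). G s t) \<in> borel_measurable borel"
  shows "(\<integral>\<^sup>+(s, t). G s t \<partial>lebesgue_on pos_quadrant)
    = (\<integral>\<^sup>+t\<in>{0<..}. (\<integral>\<^sup>+s\<in>{0<..}. G s t \<partial>lborel) \<partial>lborel)"
proof -
  have Q: "pos_quadrant \<in> sets borel"
    by (intro borel_open open_Times) auto
  have "(\<integral>\<^sup>+(s, t). G s t \<partial>lebesgue_on pos_quadrant)
      = (\<integral>\<^sup>+p. (case p of (s, t) \<Rightarrow> G s t) * indicator pos_quadrant p \<partial>lborel)"
    using Q by (subst nn_integral_restrict_space) (auto simp: nn_integral_completion)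
  also have "\<dots> = (\<integral>\<^sup>+(s, t). G s t * indicator pos_quadrant (s, t) \<partial>lborel)"
    by (intro nn_integral_cong) auto
  also have "\<dots> = (\<integral>\<^sup>+t. (\<integral>\<^sup>+s. G s t * indicator pos_quadrant (s, t) \<partial>lborel) \<partial>lborel)"
  proof (rule nn_integral_lborel_prod(2)[symmetric])
    have "(\<lambda>p. (case p of (s, t) \<Rightarrow> G s t) * indicator pos_quadrant p) \<in> borel_measurable borel"
      using G Q by (intro borel_measurable_times_ennreal borel_measurable_indicator) auto
    moreover have "(\<lambda>p. (case p of (s, t) \<Rightarrow> G s t) * indicator pos_quadrant p)
        = (\<lambda>(s, t). G s t * indicator pos_quadrant (s, t))"
      by (rule ext) auto
    ultimately show "(\<lambda>(s, t). G s t * indicator pos_quadrant (s, t)) \<in> borel_measurable borel"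
      by (simp only:)
  qed
  also have "\<dots> = (\<integral>\<^sup>+t\<in>{0<..}. (\<integral>\<^sup>+s\<in>{0<..}. G s t \<partial>lborel) \<partial>lborel)"
    by (intro nn_integral_cong) (auto simp: indicator_times split: split_indicator)
  finally show ?thesis .
qed

text \<open>
  By Fubini, a Borel function that agrees with the modulus almost everywhere agrees with it almost
  everywhere on almost every section. The passage to it therefore changes
  \<open>x \<mapsto> f\<^sub>y\<^sup>*(x,t)\<close> only on a null set of \<open>x\<close> that is the same for all \<open>t\<close>. Hence the iterated
  rearrangements agree at every \<open>(s,t)\<close>.
\<close>

lemma borel_modulus:
  fixes f :: "real \<times> real \<Rightarrow> 'a::real_normed_field"
  assumes "f \<in> borel_measurable lebesgue"
  obtains F :: "real \<Rightarrow> real \<Rightarrow> real"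
  where "(\<lambda>(x, y). F x y) \<in> borel_measurable borel" "\<And>x y. 0 \<le> F x y"
    "AE p in lborel. norm (f p) = (case p of (x, y) \<Rightarrow> F x y)"
    "\<And>s t. rearr_2 f s t = decr_rearr (\<lambda>x. decr_rearr (\<lambda>y. ennreal (F x y)) t) s"
proof -
  have "(\<lambda>p. norm (f p)) \<in> borel_measurable lebesgue"
    using assms by measurable
  then obtain F0 where F0: "F0 \<in> borel_measurable lborel" "AE p in lborel. norm (f p) = F0 p"
    using completion_ex_borel_measurable_real by blast
  define F where "F x y = \<bar>F0 (x, y)\<bar>" for x y
  have F_eq: "(\<lambda>(x, y). F x y) = (\<lambda>p. \<bar>F0 p\<bar>)" by (auto simp: F_def)
  have F: "(\<lambda>(x, y). F x y) \<in> borel_measurable borel"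
    unfolding F_eq using F0(1) by simp
  have F': "(\<lambda>(x, y). ennreal (F x y)) \<in> borel_measurable borel"
    using measurable_compose[OF F measurable_ennreal] by (simp add: case_prod_beta)
  have ae: "AE p in lborel. norm (f p) = (case p of (x, y) \<Rightarrow> F x y)"
    using F0(2) by eventually_elim (auto simp: F_def, metis abs_of_nonneg norm_ge_zero)
  then have "AE p in lborel \<Otimes>\<^sub>M lborel. norm (f p) = (case p of (x, y) \<Rightarrow> F x y)"
    unfolding lborel_prod .
  from lborel_pair.AE_pair[OF this] have "AE x in lborel. AE y in lborel. norm (f (x, y)) = F x y"
    by simp
  then have "AE x in lborel. \<forall>t. rearr_y f x t = decr_rearr (\<lambda>y. ennreal (F x y)) t"
  proof eventually_elim
    case (elim x)
    show ?case unfolding rearr_y_def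
      by (intro allI decr_rearr_cong_AE measurable_section[OF F', of x])
         (use elim in \<open>auto elim!: eventually_mono\<close>)
  qed
  then have "rearr_2 f s t = decr_rearr (\<lambda>x. decr_rearr (\<lambda>y. ennreal (F x y)) t) s" for s t
    unfolding rearr_2_def
    by (intro decr_rearr_cong_AE measurable_section[OF measurable_swap_curried[OF measurable_decr_rearr_section[OF F']]])
       (auto elim!: eventually_mono)
  then show ?thesis using F ae by (intro that) (auto simp: F_def)
qed

lemma iterated_hardy_littlewood:
  fixes F H :: "real \<Rightarrow> real \<Rightarrow> ennreal"
  assumes F: "(\<lambda>(x, y). F x y) \<in> borel_measurable borel"
    and H: "(\<lambda>(x, y). H x y) \<in> borel_measurable borel"
  shows "(\<integral>\<^sup>+x. (\<integral>\<^sup>+y. F x y * H x y \<partial>lborel) \<partial>lborel)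
    \<le> (\<integral>\<^sup>+t\<in>{0<..}. (\<integral>\<^sup>+s\<in>{0<..}. decr_rearr (\<lambda>x. decr_rearr (F x) t) s
          * decr_rearr (\<lambda>x. decr_rearr (H x) t) s \<partial>lborel) \<partial>lborel)"
proof -
  let ?G = "\<lambda>x t. decr_rearr (F x) t * decr_rearr (H x) t * indicator {0<..} t"
  note F1 = measurable_decr_rearr_section[OF F] and H1 = measurable_decr_rearr_section[OF H]
  have G: "(\<lambda>(x, t). ?G x t) \<in> borel_measurable borel"
  proof -
    have "(\<lambda>p. (case p of (x, t) \<Rightarrow> decr_rearr (F x) t) * (case p of (x, t) \<Rightarrow> decr_rearr (H x) t)
        * indicator {0<..} (snd p)) \<in> borel_measurable borel"
      unfolding borel_prod[symmetric]
      by (intro borel_measurable_times_ennreal F1[folded borel_prod] H1[folded borel_prod]) measurable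
    moreover have "(\<lambda>p. (case p of (x, t) \<Rightarrow> decr_rearr (F x) t) * (case p of (x, t) \<Rightarrow> decr_rearr (H x) t)
        * indicator {0<..} (snd p)) = (\<lambda>(x, t). ?G x t)"
      by (rule ext) auto
    ultimately show ?thesis by (simp only:)
  qed
  have "(\<integral>\<^sup>+x. (\<integral>\<^sup>+y. F x y * H x y \<partial>lborel) \<partial>lborel) \<le> (\<integral>\<^sup>+x. (\<integral>\<^sup>+t. ?G x t \<partial>lborel) \<partial>lborel)"
    by (rule nn_integral_mono, rule hardy_littlewood[OF measurable_section[OF F] measurable_section[OF H]])
  also have "\<dots> = (\<integral>\<^sup>+t. (\<integral>\<^sup>+x. ?G x t \<partial>lborel) \<partial>lborel)"
    unfolding nn_integral_lborel_prod[OF G] ..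
  also have "\<dots> = (\<integral>\<^sup>+t\<in>{0<..}. (\<integral>\<^sup>+x. decr_rearr (F x) t * decr_rearr (H x) t \<partial>lborel) \<partial>lborel)"
    by (intro nn_integral_cong) (simp split: split_indicator)
  also have "\<dots> \<le> (\<integral>\<^sup>+t\<in>{0<..}. (\<integral>\<^sup>+s\<in>{0<..}. decr_rearr (\<lambda>x. decr_rearr (F x) t) s
          * decr_rearr (\<lambda>x. decr_rearr (H x) t) s \<partial>lborel) \<partial>lborel)"
  proof (rule nn_integral_mono, rule mult_right_mono)
    fix t
    have "(\<lambda>x. decr_rearr (F x) t) \<in> borel_measurable borel" "(\<lambda>x. decr_rearr (H x) t) \<in> borel_measurable borel"
      using measurable_section[OF measurable_swap_curried[OF F1], of t]
        measurable_section[OF measurable_swap_curried[OF H1], of t] by this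
    then show "(\<integral>\<^sup>+x. decr_rearr (F x) t * decr_rearr (H x) t \<partial>lborel)
        \<le> (\<integral>\<^sup>+s\<in>{0<..}. decr_rearr (\<lambda>x. decr_rearr (F x) t) s * decr_rearr (\<lambda>x. decr_rearr (H x) t) s \<partial>lborel)"
      by (rule hardy_littlewood)
  qed simp
  finally show ?thesis .
qed

section \<open>Test functions that nearly attain the supremum\<close>

text \<open>
  For \<open>\<bar>x\<bar> \<le> n\<close> the section is \<open>w\<close> composed with the rank of the dyadic approximation on \<open>[-n,n]\<close>,
  which is equimeasurable with \<open>w\<close> on \<open>(0, 2 n)\<close>. For \<open>\<bar>x\<bar> > n\<close> the section is \<open>w\<close> itself.
  These \<open>x\<close> form a set of infinite measure, and no other section has a larger rearrangement, so
  rearranging in \<open>x\<close> gives a function constant in \<open>s\<close>.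
\<close>

lemma exists_test_function:
  fixes F :: "real \<Rightarrow> real \<Rightarrow> real" and w :: "real \<Rightarrow> real" and n :: nat
  assumes F: "(\<lambda>(x, y). F x y) \<in> borel_measurable borel" "\<And>x y. 0 \<le> F x y"
    and w [measurable]: "w \<in> borel_measurable borel" and w_nonneg: "\<And>t. 0 \<le> w t"
  obtains H :: "real \<Rightarrow> real \<Rightarrow> real"
  where "(\<lambda>(x, y). H x y) \<in> borel_measurable borel" "\<And>x y. 0 \<le> H x y"
    "\<And>s t. decr_rearr (\<lambda>x. decr_rearr (\<lambda>y. ennreal (H x y)) t) s = decr_rearr (\<lambda>t. ennreal (w t)) t"
    "\<And>x. x \<in> {-real n..real n} \<Longrightarrow>
      (\<integral>\<^sup>+t\<in>{0<..}. decr_rearr (\<lambda>y. ennreal (dyadic_floor n (F x y)) * indicator {-real n..real n} y) t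
          * ennreal (w t) \<partial>lborel)
      \<le> (\<integral>\<^sup>+y. ennreal (F x y) * ennreal (H x y) \<partial>lborel)"
proof -
  define B where "B = {-real n..real n}"
  define k where "k x y = \<lfloor>2 ^ n * F x y\<rfloor>" for x y
  define H where "H x y = (if x \<in> B then w (rearr_rank (real n) (k x) y) * indicator B y else w y)" for x y
  have Fp: "(\<lambda>p. F (fst p) (snd p)) \<in> borel_measurable borel"
    using F(1) by (simp add: case_prod_beta')
  have k: "(\<lambda>(x, y). real_of_int (k x y)) \<in> borel_measurable borel"
    unfolding k_def case_prod_beta' using Fp by measurable
  have k1: "(\<lambda>y. real_of_int (k x y)) \<in> borel_measurable borel" for x
    using measurable_section[OF k, of x] .
  have rk: "(\<lambda>p. rearr_rank (real n) (k (fst p)) (snd p)) \<in> borel_measurable (borel \<Otimes>\<^sub>M borel)"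
    using measurable_rearr_rank[OF k, of "real n"] by (simp add: case_prod_beta' borel_prod)
  have H: "(\<lambda>(x, y). H x y) \<in> borel_measurable borel"
    unfolding H_def B_def case_prod_beta' borel_prod[symmetric] using rk by measurable
  let ?W = "decr_rearr (\<lambda>t. ennreal (w t))"
  have H_in: "decr_rearr (\<lambda>y. ennreal (H x y)) t \<le> ?W t" if "x \<in> B" for x t
  proof -
    have "(\<lambda>y. ennreal (H x y)) = (\<lambda>y. ennreal (w (rearr_rank (real n) (k x) y)) * indicator B y)"
      using that by (auto simp: H_def fun_eq_iff split: split_indicator)
    then show ?thesis
      using decr_rearr_rank_le[OF _ k1, of "real n" "\<lambda>t. ennreal (w t)" x t] by (simp add: B_def)
  qed
  have H_out: "decr_rearr (\<lambda>y. ennreal (H x y)) t = ?W t" if "x \<notin> B" for x t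
    using that by (simp add: H_def)
  have meas: "(\<lambda>x. decr_rearr (\<lambda>y. ennreal (H x y)) t) \<in> borel_measurable borel" for t
  proof -
    have "(\<lambda>(x, y). ennreal (H x y)) \<in> borel_measurable borel"
      using measurable_compose[OF H measurable_ennreal] by (simp add: case_prod_beta')
    from measurable_section[OF measurable_swap_curried[OF measurable_decr_rearr_section[OF this]], of t]
    show ?thesis .
  qed
  have rearr: "decr_rearr (\<lambda>x. decr_rearr (\<lambda>y. ennreal (H x y)) t) s = ?W t" for s t
  proof (rule antisym; rule ccontr)
    assume "\<not> decr_rearr (\<lambda>x. decr_rearr (\<lambda>y. ennreal (H x y)) t) s \<le> ?W t"
    then have "ennreal s < emeasure lborel {x. ?W t < decr_rearr (\<lambda>y. ennreal (H x y)) t}"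
      by (simp add: not_le less_decr_rearr_iff[OF meas])
    moreover have "{x. ?W t < decr_rearr (\<lambda>y. ennreal (H x y)) t} = {}"
      using H_in[of _ t] H_out[of _ t] by (metis (mono_tags, lifting) empty_Collect_eq leD less_irrefl)
    ultimately show False by simp
  next
    let ?l = "decr_rearr (\<lambda>x. decr_rearr (\<lambda>y. ennreal (H x y)) t) s"
    assume "\<not> ?W t \<le> ?l"
    then have "{real n<..} \<subseteq> {x. ?l < decr_rearr (\<lambda>y. ennreal (H x y)) t}"
      using H_out by (auto simp: B_def)
    then have "emeasure lborel {real n<..} \<le> emeasure lborel {x. ?l < decr_rearr (\<lambda>y. ennreal (H x y)) t}"
      by (rule emeasure_mono) (use meas in measurable)
    then have "?l < ?l"
      by (subst less_decr_rearr_iff[OF meas]) (simp add: emeasure_lborel_greaterThan top_unique)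
    then show False by simp
  qed
  have "(\<integral>\<^sup>+t\<in>{0<..}. decr_rearr (\<lambda>y. ennreal (dyadic_floor n (F x y)) * indicator B y) t * ennreal (w t) \<partial>lborel)
      \<le> (\<integral>\<^sup>+y. ennreal (F x y) * ennreal (H x y) \<partial>lborel)" if x: "x \<in> B" for x
  proof -
    have "(\<integral>\<^sup>+t\<in>{0<..}. decr_rearr (\<lambda>y. ennreal (dyadic_floor n (F x y)) * indicator B y) t * ennreal (w t) \<partial>lborel)
        \<le> (\<integral>\<^sup>+y\<in>B. ennreal (dyadic_floor n (F x y)) * ennreal (w (rearr_rank (real n) (k x) y)) \<partial>lborel)"
      using nn_integral_decr_rearr_rank_le[of "real n" "2 ^ n" "k x" "\<lambda>t. ennreal (w t)"] k1[of x]
      by (simp add: B_def dyadic_floor_def k_def)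
    also have "\<dots> \<le> (\<integral>\<^sup>+y. ennreal (F x y) * ennreal (H x y) \<partial>lborel)"
      using x by (intro nn_integral_mono)
        (auto simp: H_def split: split_indicator intro!: mult_right_mono ennreal_leI dyadic_floor_le)
    finally show ?thesis .
  qed
  then show ?thesis
    using H rearr by (intro that[of H]) (auto simp: H_def B_def w_nonneg)
qed

text \<open>
  Truncating in \<open>x\<close>, in \<open>y\<close> and in the values of \<open>F\<close> gives an increasing sequence. Its
  rearrangements in \<open>y\<close> increase to that of \<open>F\<close> by \<open>decr_rearr_SUP\<close>, and monotone convergence
  applies.
\<close>

lemma nn_integral_rearr_y_approx:
  fixes F :: "real \<Rightarrow> real \<Rightarrow> real" and w :: "real \<Rightarrow> ennreal"
  assumes F: "(\<lambda>(x, y). F x y) \<in> borel_measurable borel"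
    and [measurable]: "w \<in> borel_measurable borel"
  shows "(\<integral>\<^sup>+x. (\<integral>\<^sup>+t\<in>{0<..}. decr_rearr (\<lambda>y. ennreal (F x y)) t * w t \<partial>lborel) \<partial>lborel)
    = (SUP n. \<integral>\<^sup>+x\<in>{-real n..real n}. (\<integral>\<^sup>+t\<in>{0<..}.
        decr_rearr (\<lambda>y. ennreal (dyadic_floor n (F x y)) * indicator {-real n..real n} y) t * w t
        \<partial>lborel) \<partial>lborel)"
proof -
  define T where "T n x y = ennreal (dyadic_floor n (F x y)) * indicator {-real n..real n} y" for n x y
  define P where "P n x t = decr_rearr (T n x) t * w t * indicator {0<..} t * indicator {-real n..real n} x" for n x t
  have Fp: "(\<lambda>p. F (fst p) (snd p)) \<in> borel_measurable (borel \<Otimes>\<^sub>M borel)"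
    using F by (simp add: case_prod_beta' borel_prod)
  have T: "(\<lambda>(x, y). T n x y) \<in> borel_measurable borel" for n
    unfolding T_def dyadic_floor_def case_prod_beta' borel_prod[symmetric] using Fp by measurable
  have P: "(\<lambda>(x, t). P n x t) \<in> borel_measurable (borel \<Otimes>\<^sub>M borel)" for n
  proof -
    have "(\<lambda>p. decr_rearr (T n (fst p)) (snd p)) \<in> borel_measurable (borel \<Otimes>\<^sub>M borel)"
      using measurable_decr_rearr_section[OF T] by (simp add: case_prod_beta' borel_prod)
    then show ?thesis unfolding P_def case_prod_beta' by measurable
  qed
  have inc_T: "incseq (\<lambda>n. T n x)" for x
    using dyadic_truncation_incseq by (auto simp: T_def incseq_def le_fun_def)
  have inc_R: "incseq (\<lambda>n. decr_rearr (T n x) t)" for x t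
    by (intro incseq_SucI decr_rearr_mono_distr measurable_section[OF T] emeasure_mono)
       (use inc_T[of x] measurable_section[OF T] in \<open>auto simp: incseq_def le_fun_def intro: less_le_trans\<close>)
  have inc: "incseq (\<lambda>n. P n x t)" for x t
    unfolding P_def by (intro incseq_SucI mult_mono incseq_SucD[OF inc_R]) (auto split: split_indicator)
  have SUP: "(SUP n. P n x t) = decr_rearr (\<lambda>y. ennreal (F x y)) t * w t * indicator {0<..} t" for x t
  proof (rule LIMSEQ_unique[OF LIMSEQ_SUP[OF inc]])
    let ?c = "w t * indicator {0<..} t"
    have "incseq (\<lambda>n. decr_rearr (T n x) t * ?c)"
      by (intro incseq_SucI mult_right_mono incseq_SucD[OF inc_R]) simp
    then have "(\<lambda>n. decr_rearr (T n x) t * ?c) \<longlonglongrightarrow> (SUP n. decr_rearr (T n x) t * ?c)"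
      by (rule LIMSEQ_SUP)
    also have "(SUP n. decr_rearr (T n x) t * ?c) = (SUP n. decr_rearr (T n x) t) * ?c"
      by (rule SUP_mult_right_ennreal[symmetric])
    also have "(SUP n. decr_rearr (T n x) t) = decr_rearr (\<lambda>y. ennreal (F x y)) t"
      using decr_rearr_SUP[OF measurable_section[OF T] inc_T, of x t]
      by (simp add: T_def dyadic_truncation_SUP)
    finally have "(\<lambda>n. decr_rearr (T n x) t * ?c) \<longlonglongrightarrow> decr_rearr (\<lambda>y. ennreal (F x y)) t * ?c" .
    moreover have "\<forall>\<^sub>F n in sequentially. decr_rearr (T n x) t * ?c = P n x t"
      using eventually_ge_at_top[of "nat \<lceil>\<bar>x\<bar>\<rceil>"]
    proof eventually_elim
      case (elim n)
      then have "\<bar>x\<bar> \<le> real n" by linarith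
      then have "x \<in> {-real n..real n}" by auto
      then show ?case by (simp add: P_def mult.assoc)
    qed
    ultimately show "(\<lambda>n. P n x t) \<longlonglongrightarrow> decr_rearr (\<lambda>y. ennreal (F x y)) t * w t * indicator {0<..} t"
      unfolding mult.assoc by (rule Lim_transform_eventually)
  qed
  have "(\<integral>\<^sup>+x. (\<integral>\<^sup>+t\<in>{0<..}. decr_rearr (\<lambda>y. ennreal (F x y)) t * w t \<partial>lborel) \<partial>lborel)
    = (\<integral>\<^sup>+x. (\<integral>\<^sup>+t. (SUP n. P n x t) \<partial>lborel) \<partial>lborel)"
    by (simp add: SUP)
  also have "\<dots> = (\<integral>\<^sup>+x. (SUP n. \<integral>\<^sup>+t. P n x t \<partial>lborel) \<partial>lborel)"
  proof (intro nn_integral_cong nn_integral_monotone_convergence_SUP)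
    show "incseq (\<lambda>n t. P n x t)" for x using inc by (auto simp: incseq_def le_fun_def)
    show "(\<lambda>t. P n x t) \<in> borel_measurable lborel" for n x
      using measurable_section[OF P[unfolded borel_prod], of n x] by simp
  qed
  also have "\<dots> = (SUP n. \<integral>\<^sup>+x. (\<integral>\<^sup>+t. P n x t \<partial>lborel) \<partial>lborel)"
  proof (rule nn_integral_monotone_convergence_SUP)
    show "incseq (\<lambda>n x. \<integral>\<^sup>+t. P n x t \<partial>lborel)"
      using inc by (auto simp: incseq_def le_fun_def intro!: nn_integral_mono)
    have "(\<lambda>(x, t). P n x t) \<in> borel_measurable (lborel \<Otimes>\<^sub>M lborel)" for n
      using P[of n] by (simp add: lborel_prod borel_prod)
    then show "(\<lambda>x. \<integral>\<^sup>+t. P n x t \<partial>lborel) \<in> borel_measurable lborel" for n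
      by (rule lborel.borel_measurable_nn_integral)
  qed
  finally have "(\<integral>\<^sup>+x. (\<integral>\<^sup>+t\<in>{0<..}. decr_rearr (\<lambda>y. ennreal (F x y)) t * w t \<partial>lborel) \<partial>lborel)
    = (SUP n. \<integral>\<^sup>+x. (\<integral>\<^sup>+t. P n x t \<partial>lborel) \<partial>lborel)" .
  moreover have "(\<integral>\<^sup>+x. (\<integral>\<^sup>+t. P n x t \<partial>lborel) \<partial>lborel) = (\<integral>\<^sup>+x\<in>{-real n..real n}. (\<integral>\<^sup>+t\<in>{0<..}.
        decr_rearr (\<lambda>y. ennreal (dyadic_floor n (F x y)) * indicator {-real n..real n} y) t * w t
        \<partial>lborel) \<partial>lborel)" for n
    unfolding P_def T_def by (intro nn_integral_cong) (simp split: split_indicator)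
  ultimately show ?thesis by (simp only:)
qed

lemma nn_integral_lebesgue_prod_AE:
  fixes G :: "real \<Rightarrow> real \<Rightarrow> ennreal"
  assumes "(\<lambda>(x, y). G x y) \<in> borel_measurable borel"
    and "AE p in lborel. g p = (case p of (x, y) \<Rightarrow> G x y)"
  shows "(\<integral>\<^sup>+(x, y). g (x, y) \<partial>lebesgue) = (\<integral>\<^sup>+x. (\<integral>\<^sup>+y. G x y \<partial>lborel) \<partial>lborel)"
proof -
  have "(\<integral>\<^sup>+(x, y). g (x, y) \<partial>lebesgue) = (\<integral>\<^sup>+p. g p \<partial>lborel)"
    by (simp add: nn_integral_completion)
  also have "\<dots> = (\<integral>\<^sup>+(x, y). G x y \<partial>lborel)"
    using assms(2) by (rule nn_integral_cong_AE)
  finally show ?thesis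
    by (simp only: nn_integral_lborel_prod(1)[OF assms(1)])
qed

section \<open>The supremum over functions with given iterated rearrangement\<close>

theorem proposition3p11:
  fixes v :: "real \<Rightarrow> real"
    and f :: "real \<times> real \<Rightarrow> 'a::real_normed_field"
  assumes v_nonneg: "\<And>t. 0 < t \<Longrightarrow> 0 \<le> v t"
    and v_decreasing: "antimono_on {0<..} v"
    and f_measurable: "f \<in> borel_measurable lebesgue"
  shows "(SUP h \<in> {h :: real \<times> real \<Rightarrow> 'a. h \<in> borel_measurable lebesgue \<and>
                     (AE (s, t) in lebesgue_on pos_quadrant. rearr_2 h s t = ennreal (v t))}.
            \<integral>\<^sup>+ (x, y). ennreal (norm (f (x, y) * h (x, y))) \<partial>lebesgue)
         = (\<integral>\<^sup>+ (s, t). rearr_2 f s t * ennreal (v t) \<partial>lebesgue_on pos_quadrant)"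
    (is "(SUP h \<in> ?A. ?I h) = ?R")
proof (rule antisym)
  from f_measurable obtain F where F: "(\<lambda>(x, y). F x y) \<in> borel_measurable borel"
      "\<And>x y. 0 \<le> F x y" "AE p in lborel. norm (f p) = (case p of (x, y) \<Rightarrow> F x y)"
      "\<And>s t. rearr_2 f s t = decr_rearr (\<lambda>x. decr_rearr (\<lambda>y. ennreal (F x y)) t) s"
    by (rule borel_modulus) blast
  have Fe: "(\<lambda>(x, y). ennreal (F x y)) \<in> borel_measurable borel"
    using measurable_compose[OF F(1) measurable_ennreal] by (simp add: case_prod_beta')
  have pairing: "?I h = (\<integral>\<^sup>+x. (\<integral>\<^sup>+y. ennreal (F x y) * ennreal (H x y) \<partial>lborel) \<partial>lborel)"
    if H: "(\<lambda>(x, y). H x y) \<in> borel_measurable borel"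
      "AE p in lborel. norm (h p) = (case p of (x, y) \<Rightarrow> H x y)"
    for h :: "real \<times> real \<Rightarrow> 'a" and H
  proof (rule nn_integral_lebesgue_prod_AE)
    show "(\<lambda>(x, y). ennreal (F x y) * ennreal (H x y)) \<in> borel_measurable borel"
      using F(1) H(1) by (simp add: case_prod_beta')
    show "AE p in lborel. ennreal (norm (f p * h p)) = (case p of (x, y) \<Rightarrow> ennreal (F x y) * ennreal (H x y))"
      using F(3) H(2)
    proof eventually_elim
      case (elim p)
      then show ?case by (cases p) (simp add: norm_mult F(2) ennreal_mult')
    qed
  qed

  show "(SUP h \<in> ?A. ?I h) \<le> ?R"
  proof (rule SUP_least)
    fix h :: "real \<times> real \<Rightarrow> 'a" assume h: "h \<in> ?A"
    then have "h \<in> borel_measurable lebesgue" by simp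
    then obtain H where H: "(\<lambda>(x, y). H x y) \<in> borel_measurable borel"
        "\<And>x y. 0 \<le> H x y" "AE p in lborel. norm (h p) = (case p of (x, y) \<Rightarrow> H x y)"
        "\<And>s t. rearr_2 h s t = decr_rearr (\<lambda>x. decr_rearr (\<lambda>y. ennreal (H x y)) t) s"
      by (rule borel_modulus) blast
    have He: "(\<lambda>(x, y). ennreal (H x y)) \<in> borel_measurable borel"
      using measurable_compose[OF H(1) measurable_ennreal] by (simp add: case_prod_beta')
    have "?I h = (\<integral>\<^sup>+x. (\<integral>\<^sup>+y. ennreal (F x y) * ennreal (H x y) \<partial>lborel) \<partial>lborel)"
      by (rule pairing[OF H(1,3)])
    also have "\<dots> \<le> (\<integral>\<^sup>+t\<in>{0<..}. (\<integral>\<^sup>+s\<in>{0<..}. rearr_2 f s t * rearr_2 h s t \<partial>lborel) \<partial>lborel)"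
      unfolding F(4) H(4) by (rule iterated_hardy_littlewood[OF Fe He])
    also have "\<dots> = (\<integral>\<^sup>+(s, t). rearr_2 f s t * rearr_2 h s t \<partial>lebesgue_on pos_quadrant)"
    proof (rule nn_integral_pos_quadrant[symmetric])
      show "(\<lambda>(s, t). rearr_2 f s t * rearr_2 h s t) \<in> borel_measurable borel"
        unfolding F(4) H(4)
        using measurable_iterated_rearr[OF Fe] measurable_iterated_rearr[OF He]
        by (simp add: case_prod_beta' borel_measurable_times_ennreal)
    qed
    also have "\<dots> = ?R"
      using h by (intro nn_integral_cong_AE) (auto elim!: eventually_mono)
    finally show "?I h \<le> ?R" .
  qed

  \<comment> \<open>The values of \<open>v\<close> outside \<open>(0, \<infinity>)\<close> are arbitrary and must not enter the test functions.\<close>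
  define w where "w t = (if 0 < t then v t else 0)" for t
  have w_zero: "w t = 0" if "t \<le> 0" for t using that by (simp add: w_def)
  have w_nonneg: "0 \<le> w t" for t using v_nonneg by (simp add: w_def)
  have w_anti: "w t \<le> w s" if "0 < s" "s \<le> t" for s t
    using v_decreasing that by (auto simp: w_def monotone_on_def)
  have w [measurable]: "w \<in> borel_measurable borel"
  proof -
    have "(\<lambda>t. - v t) \<in> borel_measurable (restrict_space borel {0<..})"
      by (rule borel_measurable_mono_on_fnc) (use v_decreasing in \<open>auto simp: monotone_on_def\<close>)
    from borel_measurable_uminus[OF this] have "v \<in> borel_measurable (restrict_space borel {0<..})"
      by simp
    then have "(\<lambda>t. if t \<in> {0<..} then v t else 0) \<in> borel_measurable borel"
      by (subst (asm) measurable_restrict_space_iff[where c = 0]) auto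
    then show ?thesis by (simp add: w_def[abs_def])
  qed
  let ?W = "decr_rearr (\<lambda>t. ennreal (w t))"
  have W: "AE t in lborel. 0 < t \<longrightarrow> ?W t = ennreal (w t)"
    by (rule AE_decr_rearr_antimono) (measurable, simp_all add: w_anti ennreal_leI w_zero)

  have Fw: "(\<lambda>(x, t). decr_rearr (\<lambda>y. ennreal (F x y)) t * (ennreal (w t) * indicator {0<..} t)) \<in> borel_measurable borel"
  proof -
    have "(\<lambda>p. decr_rearr (\<lambda>y. ennreal (F (fst p) y)) (snd p)) \<in> borel_measurable (borel \<Otimes>\<^sub>M borel)"
      using measurable_decr_rearr_section[OF Fe] by (simp add: case_prod_beta' borel_prod)
    then show ?thesis unfolding case_prod_beta' borel_prod[symmetric] by measurable
  qed
  have Fy: "(\<lambda>x. decr_rearr (\<lambda>y. ennreal (F x y)) t) \<in> borel_measurable borel" for t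
    using measurable_section[OF measurable_swap_curried[OF measurable_decr_rearr_section[OF Fe]], of t] .
  have "?R = (\<integral>\<^sup>+(s, t). rearr_2 f s t * ennreal (w t) \<partial>lebesgue_on pos_quadrant)"
    by (intro nn_integral_cong) (auto simp: w_def space_restrict_space)
  also have "\<dots> = (\<integral>\<^sup>+t\<in>{0<..}. (\<integral>\<^sup>+s\<in>{0<..}. rearr_2 f s t * ennreal (w t) \<partial>lborel) \<partial>lborel)"
  proof (rule nn_integral_pos_quadrant)
    have "(\<lambda>p. decr_rearr (\<lambda>x. decr_rearr (\<lambda>y. ennreal (F x y)) (snd p)) (fst p)) \<in> borel_measurable (borel \<Otimes>\<^sub>M borel)"
      using measurable_iterated_rearr[OF Fe] by (simp add: case_prod_beta' borel_prod)
    then show "(\<lambda>(s, t). rearr_2 f s t * ennreal (w t)) \<in> borel_measurable borel"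
      unfolding F(4) case_prod_beta' borel_prod[symmetric] by measurable
  qed
  also have "\<dots> = (\<integral>\<^sup>+t. (\<integral>\<^sup>+x. decr_rearr (\<lambda>y. ennreal (F x y)) t * (ennreal (w t) * indicator {0<..} t) \<partial>lborel) \<partial>lborel)"
  proof (rule nn_integral_cong)
    fix t :: real
    note [measurable] = Fy[of t]
    have "(\<integral>\<^sup>+s\<in>{0<..}. rearr_2 f s t * ennreal (w t) \<partial>lborel)
        = (\<integral>\<^sup>+s. rearr_2 f s t * indicator {0<..} s * ennreal (w t) \<partial>lborel)"
      by (simp add: mult_ac)
    also have "\<dots> = (\<integral>\<^sup>+s\<in>{0<..}. rearr_2 f s t \<partial>lborel) * ennreal (w t)"
      unfolding F(4) by (rule nn_integral_multc) measurable
    also have "\<dots> = (\<integral>\<^sup>+x. decr_rearr (\<lambda>y. ennreal (F x y)) t \<partial>lborel) * ennreal (w t)"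
      unfolding F(4) by (simp only: nn_integral_decr_rearr[OF Fy])
    finally show "(\<integral>\<^sup>+s\<in>{0<..}. rearr_2 f s t * ennreal (w t) \<partial>lborel) * indicator {0<..} t
      = (\<integral>\<^sup>+x. decr_rearr (\<lambda>y. ennreal (F x y)) t * (ennreal (w t) * indicator {0<..} t) \<partial>lborel)"
      using Fy[of t] by (simp add: nn_integral_multc mult.assoc)
  qed
  also have "\<dots> = (\<integral>\<^sup>+x. (\<integral>\<^sup>+t\<in>{0<..}. decr_rearr (\<lambda>y. ennreal (F x y)) t * ennreal (w t) \<partial>lborel) \<partial>lborel)"
    unfolding nn_integral_lborel_prod(2)[OF Fw] nn_integral_lborel_prod(1)[OF Fw, symmetric]
    by (simp only: mult.assoc)
  also have "\<dots> = (SUP n. \<integral>\<^sup>+x\<in>{-real n..real n}. (\<integral>\<^sup>+t\<in>{0<..}.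
        decr_rearr (\<lambda>y. ennreal (dyadic_floor n (F x y)) * indicator {-real n..real n} y) t * ennreal (w t)
        \<partial>lborel) \<partial>lborel)"
    by (rule nn_integral_rearr_y_approx[OF F(1)]) measurable
  also have "\<dots> \<le> (SUP h \<in> ?A. ?I h)"
  proof (rule SUP_least)
    fix n :: nat
    obtain H where H: "(\<lambda>(x, y). H x y) \<in> borel_measurable borel" "\<And>x y. 0 \<le> H x y"
      "\<And>s t. decr_rearr (\<lambda>x. decr_rearr (\<lambda>y. ennreal (H x y)) t) s = ?W t"
      "\<And>x. x \<in> {-real n..real n} \<Longrightarrow>
        (\<integral>\<^sup>+t\<in>{0<..}. decr_rearr (\<lambda>y. ennreal (dyadic_floor n (F x y)) * indicator {-real n..real n} y) t
            * ennreal (w t) \<partial>lborel)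
        \<le> (\<integral>\<^sup>+y. ennreal (F x y) * ennreal (H x y) \<partial>lborel)"
      by (rule exists_test_function[OF F(1,2) w w_nonneg, of n]) blast
    define h :: "real \<times> real \<Rightarrow> 'a" where "h p = of_real (case p of (x, y) \<Rightarrow> H x y)" for p
    have norm_h: "norm (h p) = (case p of (x, y) \<Rightarrow> H x y)" for p
      using H(2) by (simp add: h_def split: prod.split)
    have "h \<in> borel_measurable borel"
      unfolding h_def by (rule measurable_compose[OF H(1)]) measurable
    then have "h \<in> borel_measurable lebesgue"
      by (intro measurable_completion) simp
    moreover have "AE (s, t) in lebesgue_on pos_quadrant. rearr_2 h s t = ennreal (v t)"
    proof -
      have rearr_h: "rearr_2 h s t = ?W t" for s t
        by (simp add: rearr_2_def rearr_y_def norm_h H(3))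
      have "AE p in (lborel :: real measure) \<Otimes>\<^sub>M lborel. 0 < snd p \<longrightarrow> ?W (snd p) = ennreal (w (snd p))"
      proof (rule lborel_pair.AE_pair_measure)
        show "{p \<in> space ((lborel :: real measure) \<Otimes>\<^sub>M lborel). 0 < snd p \<longrightarrow> ?W (snd p) = ennreal (w (snd p))}
            \<in> sets ((lborel :: real measure) \<Otimes>\<^sub>M lborel)"
          by measurable
      qed (use W in simp)
      then have "AE p in (lebesgue :: (real \<times> real) measure). 0 < snd p \<longrightarrow> ?W (snd p) = ennreal (w (snd p))"
        unfolding lborel_prod by (rule AE_completion)
      then have "AE p in (lebesgue :: (real \<times> real) measure). p \<in> pos_quadrant \<longrightarrow> (case p of (s, t) \<Rightarrow> rearr_2 h s t = ennreal (v t))"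
        by eventually_elim (auto simp: rearr_h w_def)
      moreover have "pos_quadrant \<in> sets lebesgue"
        by (intro sets_completionI_sets) (auto intro!: borel_open open_Times)
      ultimately show ?thesis
        by (subst AE_restrict_space_iff) auto
    qed
    ultimately have "h \<in> ?A" by simp
    have "(\<integral>\<^sup>+x\<in>{-real n..real n}. (\<integral>\<^sup>+t\<in>{0<..}.
        decr_rearr (\<lambda>y. ennreal (dyadic_floor n (F x y)) * indicator {-real n..real n} y) t * ennreal (w t)
        \<partial>lborel) \<partial>lborel) \<le> (\<integral>\<^sup>+x. (\<integral>\<^sup>+y. ennreal (F x y) * ennreal (H x y) \<partial>lborel) \<partial>lborel)"
      by (intro nn_integral_mono) (simp add: H(4) split: split_indicator)
    also have "\<dots> = ?I h"
      by (rule pairing[symmetric]) (use H(1) norm_h in auto)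
    also have "\<dots> \<le> (SUP h \<in> ?A. ?I h)"
      using \<open>h \<in> ?A\<close> by (rule SUP_upper)
    finally show "(\<integral>\<^sup>+x\<in>{-real n..real n}. (\<integral>\<^sup>+t\<in>{0<..}.
        decr_rearr (\<lambda>y. ennreal (dyadic_floor n (F x y)) * indicator {-real n..real n} y) t * ennreal (w t)
        \<partial>lborel) \<partial>lborel) \<le> (SUP h \<in> ?A. ?I h)" .
  qed
  finally show "?R \<le> (SUP h \<in> ?A. ?I h)" .
qed

end
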